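(* Let $P$ be a finite set of points in the plane, no three of which are collinear, and suppose that $P$ is 4-connectible. Let $S$ be any set of consecutive points on $CH(P)$, and let $Q = P\setminus S$. Then $|CH(Q)| \leq |P'|+1$.
   Context: $CH(X)$ denotes the convex hull (boundary polygon) of a finite planar point set $X$; $|CH(X)|$ is the number of points of $X$ that are vertices of it. $P'$ is the set of points of $P$ lying in the interior of $CH(P)$. A graph is 4-connected if it has at least 5 vertices and no set of 3 vertices whose removal disconnects it. $P$ is 4-connectible if there is a 4-connected plane graph with vertex set $P$ all of whose edges are line segments. A set of consecutive points on $CH(P)$ is a set of vertices of $CH(P)$ that appear contiguously in the cyclic order along the boundary of $CH(P)$. *)

theory Defs
  imports "HOL-Analysis.Analysis"
begin

type_synonym point = "real ^ 2"

definition hull_vertices :: "point set \<Rightarrow> point set" where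
  "hull_vertices X = {x \<in> X. x extreme_point_of (convex hull X)}"

definition interior_points :: "point set \<Rightarrow> point set" where
  "interior_points P = P \<inter> interior (convex hull P)"

definition general_position :: "point set \<Rightarrow> bool" where
  "general_position P \<longleftrightarrow>
     (\<forall>x\<in>P. \<forall>y\<in>P. \<forall>z\<in>P. x \<noteq> y \<longrightarrow> y \<noteq> z \<longrightarrow> x \<noteq> z \<longrightarrow> \<not> collinear {x, y, z})"

text \<open>
  A finite simple graph is given by its vertex set \<open>V\<close> and a set \<open>E\<close> of two-element
  subsets of \<open>V\<close>.
\<close>

definition simple_graph :: "'a set \<Rightarrow> 'a set set \<Rightarrow> bool" where
  "simple_graph V E \<longleftrightarrow> finite V \<and> (\<forall>e\<in>E. e \<subseteq> V \<and> card e = 2)"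

text \<open>
  Connectedness of the subgraph induced by \<open>V\<close>: edges of \<open>E\<close> that leave \<open>V\<close> are ignored,
  so removing a vertex set \<open>C\<close> amounts to replacing \<open>V\<close> by \<open>V - C\<close>.
\<close>

definition graph_connected :: "'a set \<Rightarrow> 'a set set \<Rightarrow> bool" where
  "graph_connected V E \<longleftrightarrow>
     (\<forall>u\<in>V. \<forall>v\<in>V. (u, v) \<in> {(x, y). x \<in> V \<and> y \<in> V \<and> {x, y} \<in> E}\<^sup>*)"

definition four_connected :: "'a set \<Rightarrow> 'a set set \<Rightarrow> bool" where
  "four_connected V E \<longleftrightarrow>
     card V \<ge> 5 \<and> (\<forall>C. C \<subseteq> V \<and> card C = 3 \<longrightarrow> graph_connected (V - C) E)"

text \<open>
  The edge \<open>{x, y}\<close> is drawn as the segment \<open>convex hull {x, y}\<close>. It meets the vertex set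
  only in its end points, and two edges meet only in common end points.
\<close>

definition plane_straight_line_graph :: "point set \<Rightarrow> point set set \<Rightarrow> bool" where
  "plane_straight_line_graph V E \<longleftrightarrow>
     simple_graph V E \<and>
     (\<forall>e\<in>E. (convex hull e) \<inter> V = e) \<and>
     (\<forall>e\<in>E. \<forall>f\<in>E. e \<noteq> f \<longrightarrow> (convex hull e) \<inter> (convex hull f) = e \<inter> f)"

definition four_connectible :: "point set \<Rightarrow> bool" where
  "four_connectible P \<longleftrightarrow>
     (\<exists>E. plane_straight_line_graph P E \<and> four_connected P E)"

text \<open>
  A list of all hull vertices in their cyclic order along the boundary (in either direction,
  from any starting point): cyclically adjacent entries span an edge of the hull polygon.
\<close>

definition hull_cyclic_order :: "point set \<Rightarrow> point list \<Rightarrow> bool" where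
  "hull_cyclic_order P vs \<longleftrightarrow>
     distinct vs \<and> set vs = hull_vertices P \<and>
     (\<forall>i<length vs.
        closed_segment (vs ! i) (vs ! (Suc i mod length vs)) edge_of (convex hull P))"

text \<open>
  The empty set and the set of all hull vertices also count as consecutive.
\<close>

definition consecutive_on_hull :: "point set \<Rightarrow> point set \<Rightarrow> bool" where
  "consecutive_on_hull P S \<longleftrightarrow>
     (\<exists>vs a k. hull_cyclic_order P vs \<and> S = set (take k (rotate a vs)))"

end

theory Submission
  imports Defs
begin

text \<open>
  Say that two points see each other if no edge of the graph crosses the segment between them.
  If an interior point \<open>x\<close> sees two hull vertices \<open>a\<close>, \<open>b\<close>, then the path \<open>a x b\<close> cuts the hull in
  two, so by 4-connectivity all other points lie on one side of it; hence no interior point sees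
  three hull vertices. The \<open>m\<close> hull vertices that remain after removing \<open>S\<close> form a path with
  \<open>m - 1\<close> hull edges; each such edge has an interior apex that sees both of its ends, and
  distinct edges have distinct apexes. An interior point that becomes a hull vertex of \<open>P - S\<close>
  sees a point of \<open>S\<close>, so it is not an apex. This leaves at most \<open>m + (|P'| - (m - 1))\<close> hull
  vertices of \<open>P - S\<close>.
\<close>

section \<open>Determinants, frame coordinates and rays in the plane\<close>

definition cross2 :: "point \<Rightarrow> point \<Rightarrow> real" where
  "cross2 v w = v $ 1 * w $ 2 - v $ 2 * w $ 1"

text \<open>Cramer's rule for the coefficient of \<open>a - u\<close> when \<open>p - u\<close> is
  expanded in the basis \<open>a - u\<close>, \<open>b - u\<close>; exchanging \<open>a\<close> and
  \<open>b\<close> gives the other coefficient.\<close>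

definition coord :: "point \<Rightarrow> point \<Rightarrow> point \<Rightarrow> point \<Rightarrow> real" where
  "coord u a b p = cross2 (p - u) (b - u) / cross2 (a - u) (b - u)"

lemma cross2_swap: "cross2 w v = - cross2 v w"
  by (simp add: cross2_def algebra_simps)

lemma cross2_self [simp]: "cross2 v v = 0"
  by (simp add: cross2_def algebra_simps)

lemma cross2_zero [simp]: "cross2 0 v = 0" "cross2 v 0 = 0"
  by (simp_all add: cross2_def)

lemma cross2_lin_left: "cross2 (r *\<^sub>R v + s *\<^sub>R v') w = r * cross2 v w + s * cross2 v' w"
  by (simp add: cross2_def algebra_simps)

lemma cross2_add: "cross2 (v + v') w = cross2 v w + cross2 v' w" "cross2 w (v + v') = cross2 w v + cross2 w v'"
  by (simp_all add: cross2_def algebra_simps)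

lemma cross2_scale: "cross2 (r *\<^sub>R v) w = r * cross2 v w" "cross2 w (r *\<^sub>R v) = r * cross2 w v"
  by (simp_all add: cross2_def algebra_simps)

lemma cross2_eq_0_iff_collinear: "cross2 (a - u) (b - u) = 0 \<longleftrightarrow> collinear {u, a, b}"
proof -
  have *: "collinear {u, a, b} \<longleftrightarrow> collinear {0, a - u, b - u}"
    using collinear_3[of a u b] by (simp add: insert_commute)
  define v w where "v = a - u" and "w = b - u"
  have "cross2 v w = 0 \<longleftrightarrow> v = 0 \<or> w = 0 \<or> (\<exists>c. w = c *\<^sub>R v)"
  proof
    assume c: "cross2 v w = 0"
    show "v = 0 \<or> w = 0 \<or> (\<exists>c. w = c *\<^sub>R v)"
    proof (cases "v $ 1 = 0")
      case True
      show ?thesis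
      proof (cases "v $ 2 = 0")
        case True
        then have "v = 0" using \<open>v $ 1 = 0\<close> by (simp add: vec_eq_iff forall_2)
        then show ?thesis by simp
      next
        case False
        then have "w = (w $ 2 / v $ 2) *\<^sub>R v"
          using True c by (auto simp: vec_eq_iff forall_2 cross2_def)
        then show ?thesis by blast
      qed
    next
      case False
      then have "w = (w $ 1 / v $ 1) *\<^sub>R v"
        using c by (auto simp: vec_eq_iff forall_2 cross2_def field_simps)
      then show ?thesis by blast
    qed
  next
    assume "v = 0 \<or> w = 0 \<or> (\<exists>c. w = c *\<^sub>R v)"
    then show "cross2 v w = 0" by (auto simp: cross2_def)
  qed
  then show ?thesis
    unfolding * collinear_lemma v_def w_def .
qed

lemma cross2_eq_0_if_orthogonal:
  assumes "n \<bullet> v = 0" "n \<bullet> w = 0" "n \<noteq> 0"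
  shows "cross2 v w = 0"
proof -
  have v: "n $ 1 * v $ 1 + n $ 2 * v $ 2 = 0" and w: "n $ 1 * w $ 1 + n $ 2 * w $ 2 = 0"
    using assms(1,2) by (simp_all add: inner_vec_def sum_2)
  have "n $ 1 * cross2 v w = 0" "n $ 2 * cross2 v w = 0"
    using v w unfolding cross2_def by algebra+
  moreover have "n $ 1 \<noteq> 0 \<or> n $ 2 \<noteq> 0" using assms(3) by (auto simp: vec_eq_iff forall_2)
  ultimately show ?thesis by auto
qed

lemma frame_expansion:
  assumes "cross2 (a - u) (b - u) \<noteq> 0"
  shows "p = u + coord u a b p *\<^sub>R (a - u) + coord u b a p *\<^sub>R (b - u)"
proof -
  define v w q where "v = a - u" and "w = b - u" and "q = p - u"
  have n: "cross2 v w \<noteq> 0" using assms by (simp add: v_def w_def)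
  have "cross2 v w *\<^sub>R q = cross2 q w *\<^sub>R v + cross2 v q *\<^sub>R w"
    by (simp add: vec_eq_iff forall_2 cross2_def algebra_simps)
  then have "q = (cross2 q w / cross2 v w) *\<^sub>R v + (cross2 v q / cross2 v w) *\<^sub>R w"
    using n by (simp add: vec_eq_iff forall_2 field_simps)
  moreover have "cross2 q v / cross2 w v = cross2 v q / cross2 v w"
    by (simp add: cross2_swap[of q v] cross2_swap[of w v])
  ultimately have "p - u = coord u a b p *\<^sub>R (a - u) + coord u b a p *\<^sub>R (b - u)"
    unfolding coord_def v_def w_def q_def by simp
  then show ?thesis by (simp add: algebra_simps)
qed

lemma coord_convex:
  "coord u a b ((1 - t) *\<^sub>R p + t *\<^sub>R q) = (1 - t) * coord u a b p + t * coord u a b q"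
proof -
  have *: "(1 - t) *\<^sub>R p + t *\<^sub>R q - u = (1 - t) *\<^sub>R (p - u) + t *\<^sub>R (q - u)"
    by (simp add: algebra_simps)
  show ?thesis unfolding coord_def * cross2_lin_left by (simp add: add_divide_distrib)
qed

lemma coord_origin [simp]: "coord u a b u = 0"
  by (simp add: coord_def)

lemma coord_first [simp]: "cross2 (a - u) (b - u) \<noteq> 0 \<Longrightarrow> coord u a b a = 1"
  by (simp add: coord_def)

lemma coord_second [simp]: "coord u a b b = 0"
  by (simp add: coord_def)

text \<open>Used to find where a segment leaves a region cut out by two affine inequalities: the
  minimum of both functions is positive at 0 and not positive at 1.\<close>

lemma min_affine_root:
  fixes a b a' b' :: real
  assumes "a > 0" "b > 0" "a' \<le> 0 \<or> b' \<le> 0"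
  obtains t where "0 < t" "t \<le> 1"
    "(1 - t) * a + t * a' \<ge> 0" "(1 - t) * b + t * b' \<ge> 0"
    "(1 - t) * a + t * a' = 0 \<or> (1 - t) * b + t * b' = 0"
proof -
  define g where "g t = min ((1 - t) * a + t * a') ((1 - t) * b + t * b')" for t
  have "continuous_on {0..1} g" unfolding g_def by (intro continuous_intros)
  moreover have "g 1 \<le> 0" "0 \<le> g 0" using assms by (auto simp: g_def)
  ultimately obtain t where t: "0 \<le> t" "t \<le> 1" "g t = 0"
    using IVT2'[of g 1 0 0] by auto
  moreover have "t \<noteq> 0" using assms t(3) by (auto simp: g_def)
  ultimately show ?thesis
    by (intro that[of t]) (auto simp: g_def min_def split: if_splits)
qed

text \<open>A point of \<open>C\<close> beyond \<open>a\<close> on the ray from \<open>x\<close>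
  would put \<open>a\<close> strictly inside a segment of \<open>C\<close>.\<close>

lemma extreme_point_ray:
  fixes a x :: "'a::real_vector"
  assumes "a extreme_point_of C" "x \<in> C" "x \<noteq> a" "x + r *\<^sub>R (a - x) \<in> C"
  shows "r \<le> 1"
proof (rule ccontr)
  assume "\<not> r \<le> 1"
  then have r: "r > 1" by simp
  define y where "y = x + r *\<^sub>R (a - x)"
  have "y \<noteq> x" using r assms(3) by (simp add: y_def)
  moreover have "a = (1 - inverse r) *\<^sub>R x + inverse r *\<^sub>R y"
    using r by (simp add: y_def algebra_simps)
  ultimately have "a \<in> open_segment x y"
    using r unfolding in_segment by (intro conjI exI[of _ "inverse r"]) (auto simp: inverse_less_1_iff)
  then show False using assms unfolding extreme_point_of_def y_def by blast
qed

lemma in_closed_segment_ray: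
  fixes a x :: "'a::real_vector"
  assumes "0 \<le> r" "r \<le> 1"
  shows "x + r *\<^sub>R (a - x) \<in> closed_segment x a"
  unfolding in_segment using assms by (intro exI[of _ r]) (simp add: algebra_simps)

section \<open>Hull vertices and interior points in general position\<close>

lemma general_positionD:
  assumes "general_position P" "x \<in> P" "y \<in> P" "z \<in> P" "x \<noteq> y" "y \<noteq> z" "x \<noteq> z"
  shows "\<not> collinear {x, y, z}"
  using assms by (simp add: general_position_def)

lemma hull_vertex_notin_hull_of_rest:
  assumes "x \<in> hull_vertices P"
  shows "x \<notin> convex hull (P - {x})"
proof -
  have e: "x extreme_point_of (convex hull P)" using assms by (simp add: hull_vertices_def)
  then have "convex (convex hull P - {x})"
    by (simp add: extreme_point_of_stillconvex)
  moreover have "P - {x} \<subseteq> convex hull P - {x}" using hull_subset[of P convex] by blast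
  ultimately have "convex hull (P - {x}) \<subseteq> convex hull P - {x}"
    by (simp add: subset_hull)
  then show ?thesis by blast
qed

lemma hull_verticesI:
  assumes "finite P" "x \<in> P" "x \<notin> convex hull (P - {x})"
  shows "x \<in> hull_vertices P"
  using extreme_point_of_convex_hull_insert[of "P - {x}" x] assms
  by (simp add: hull_vertices_def insert_absorb)

text \<open>A point of the relative boundary lies on a supporting line, whose face is the hull of
  points of \<open>P\<close>. General position allows at most one of them besides \<open>x\<close>,
  so \<open>x\<close> is an end of the face and thus extreme.\<close>

lemma non_hull_vertices_interior:
  assumes fin: "finite P" and gp: "general_position P" and card: "card P \<ge> 3"
  shows "P - hull_vertices P \<subseteq> interior_points P"
proof
  fix x assume x: "x \<in> P - hull_vertices P"
  let ?C = "convex hull P"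
  have xC: "x \<in> ?C" using x by (simp add: hull_inc)
  have nc: "\<not> collinear P"
  proof
    assume "collinear P"
    obtain T where T: "T \<subseteq> P" "card T = 3" using card obtain_subset_with_card_n by metis
    then obtain a b c where "T = {a,b,c}" "a \<noteq> b" "b \<noteq> c" "a \<noteq> c"
      by (auto simp: card_3_iff)
    with T gp \<open>collinear P\<close> show False
      unfolding general_position_def by (meson collinear_subset insert_subset)
  qed
  have "\<not> aff_dim ?C \<le> 1" using nc by (simp add: collinear_aff_dim aff_dim_convex_hull)
  moreover have "aff_dim ?C \<le> 2" using aff_dim_le_DIM[of ?C] by simp
  ultimately have int: "interior ?C = rel_interior ?C" by (simp add: interior_rel_interior_gen)
  have "x \<in> rel_interior ?C"
  proof (rule ccontr)
    assume "x \<notin> rel_interior ?C"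
    from supporting_hyperplane_rel_boundary[OF convex_convex_hull xC this]
    obtain a where a: "a \<noteq> 0" "\<And>y. y \<in> ?C \<Longrightarrow> a \<bullet> x \<le> a \<bullet> y"  by metis
    let ?H = "{y. a \<bullet> y = a \<bullet> x}"
    have face: "?C \<inter> ?H face_of ?C"
      by (intro face_of_Int_supporting_hyperplane_ge convex_convex_hull) (use a in auto)
    obtain T where T: "T \<subseteq> P" "?C \<inter> ?H = convex hull T"
      using face_of_convex_hull_subset[OF _ face] fin finite_imp_compact by metis
    have TH: "T \<subseteq> ?H" using T(2) hull_subset[of T convex] by blast
    have two: "y = z" if "y \<in> T" "z \<in> T" "y \<noteq> x" "z \<noteq> x" for y z
    proof (rule ccontr)
      assume "y \<noteq> z"
      have "a \<bullet> (y - x) = 0" "a \<bullet> (z - x) = 0" using that TH by (auto simp: inner_diff_right)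
      then have "cross2 (y - x) (z - x) = 0" using a(1) by (rule cross2_eq_0_if_orthogonal)
      then have "collinear {x, y, z}" by (simp add: cross2_eq_0_iff_collinear)
      moreover have "x \<in> P" "y \<in> P" "z \<in> P" using that T(1) x by auto
      ultimately show False using general_positionD[OF gp, of x y z] that \<open>y \<noteq> z\<close> by auto
    qed
    have xT: "x \<in> convex hull T" using T(2) xC by blast
    obtain q where q: "T \<subseteq> {x, q}" 
    proof (cases "T \<subseteq> {x}")
      case False
      then obtain q where "q \<in> T" "q \<noteq> x" by blast
      with two have "T \<subseteq> {x, q}" by blast
      then show ?thesis by (rule that)
    qed (rule that[of x], simp)
    have "x extreme_point_of (convex hull T)"
    proof (cases "x \<in> T")
      case True
      then have "T = {x, x} \<or> T = {x, q}" using q by blast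
      then show ?thesis by (metis extreme_point_of_convex_hull_2)
    next
      case False
      then have "T = {} \<or> T = {q}" using q by blast
      then show ?thesis using xT by auto
    qed
    then have "x extreme_point_of ?C"
      using extreme_point_of_face[OF face] T(2) by auto
    then show False using x by (simp add: hull_vertices_def)
  qed
  then show "x \<in> interior_points P" using x int by (simp add: interior_points_def)
qed

lemma finite_has_maximizer:
  fixes f :: "'a \<Rightarrow> real"
  assumes "finite A" "A \<noteq> {}"
  obtains x where "x \<in> A" "\<And>y. y \<in> A \<Longrightarrow> f y \<le> f x"
proof -
  have "Max (f ` A) \<in> f ` A" using assms by simp
  then obtain x where "x \<in> A" "f x = Max (f ` A)" by auto
  then show ?thesis using that[of x] assms by simp
qed

text \<open>The quotients arise as \<open>coord\<close> values in
  \<open>not_sees_three_hull_vertices\<close>: lying outside a closed cone becomes a sign condition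
  on determinants.\<close>

lemma quotients_not_both_nonneg:
  fixes p q r :: real
  assumes "\<not> (- q / p \<ge> 0 \<and> r / - p \<ge> 0)"
  shows "p > 0 \<Longrightarrow> q > 0 \<or> r > 0" "p < 0 \<Longrightarrow> q < 0 \<or> r < 0"
proof -
  show "q > 0 \<or> r > 0" if "p > 0"
    using assms that divide_nonneg_pos[of "- q" p] divide_nonpos_neg[of r "- p"] by force
  show "q < 0 \<or> r < 0" if "p < 0"
    using assms that divide_nonpos_neg[of "- q" p] divide_nonneg_pos[of r "- p"] by force
qed

section \<open>Visibility in a 4-connected plane drawing\<close>

locale four_connected_drawing =
  fixes P :: "point set" and E :: "point set set"
  assumes finite_P: "finite P"
    and general_position_P: "general_position P"
    and plane: "plane_straight_line_graph P E"
    and four_connected: "four_connected P E"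
begin

text \<open>
  Using visibility instead of adjacency avoids extending \<open>E\<close> to a triangulation.
\<close>

definition sees :: "point \<Rightarrow> point \<Rightarrow> bool" where
  "sees p q \<longleftrightarrow> (\<forall>e\<in>E. p \<notin> e \<longrightarrow> q \<notin> e \<longrightarrow> convex hull e \<inter> closed_segment p q = {})"

lemma sees_commute: "sees p q \<longleftrightarrow> sees q p"
  unfolding sees_def by (metis closed_segment_commute)

lemma card_P: "card P \<ge> 5"
  using four_connected by (simp add: four_connected_def)

lemma cross2_nonzero:
  assumes "u \<in> P" "a \<in> P" "b \<in> P" "u \<noteq> a" "u \<noteq> b" "a \<noteq> b"
  shows "cross2 (a - u) (b - u) \<noteq> 0"
  using general_positionD[OF general_position_P, of u a b] assms
  by (auto simp: cross2_eq_0_iff_collinear)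

lemma edgeE:
  assumes "e \<in> E"
  obtains c d where "e = {c, d}" "c \<noteq> d" "c \<in> P" "d \<in> P"
proof -
  have "e \<subseteq> P" "card e = 2"
    using plane assms by (auto simp: plane_straight_line_graph_def simple_graph_def)
  then show ?thesis using that by (auto simp: card_2_iff)
qed

lemma edge_hull_Int_P: "e \<in> E \<Longrightarrow> convex hull e \<inter> P = e"
  using plane by (simp add: plane_straight_line_graph_def)

lemma edges_meet: "e \<in> E \<Longrightarrow> f \<in> E \<Longrightarrow> e \<noteq> f \<Longrightarrow> convex hull e \<inter> convex hull f = e \<inter> f"
  using plane by (simp add: plane_straight_line_graph_def)

lemma edge_sees:
  assumes "{p, q} \<in> E"
  shows "sees p q"
  unfolding sees_def
proof (intro ballI impI)
  fix e assume "e \<in> E" "p \<notin> e" "q \<notin> e"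
  then show "convex hull e \<inter> closed_segment p q = {}"
    using edges_meet[OF _ assms, of e] by (auto simp: segment_convex_hull)
qed

text \<open>This is how 4-connectivity enters: three removed points cannot separate \<open>p\<close>
  from \<open>q\<close>, so along a path between them \<open>R\<close> changes on some edge.\<close>

lemma crossing_edge:
  assumes "C \<subseteq> P" "card C = 3" "p \<in> P - C" "q \<in> P - C" "R p" "\<not> R q"
  obtains c d where "c \<in> P - C" "d \<in> P - C" "{c, d} \<in> E" "R c" "\<not> R d"
proof -
  have "(p, q) \<in> {(x, y). x \<in> P - C \<and> y \<in> P - C \<and> {x, y} \<in> E}\<^sup>*"
    using four_connected assms unfolding four_connected_def graph_connected_def by blast
  then have "R q \<or> (\<exists>c d. c \<in> P - C \<and> d \<in> P - C \<and> {c, d} \<in> E \<and> R c \<and> \<not> R d)"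
    using \<open>R p\<close> by (induction rule: rtrancl_induct) auto
  then show ?thesis using assms that by blast
qed

section \<open>Cuts of the hull along lines of sight to hull vertices\<close>

lemma hull_vertex_ray_in_segment:
  assumes "a \<in> hull_vertices P" "x \<in> P" "x \<noteq> a" "r \<ge> 0" "x + r *\<^sub>R (a - x) \<in> convex hull P"
  shows "x + r *\<^sub>R (a - x) \<in> closed_segment x a"
  using assms extreme_point_ray[of a "convex hull P" x r]
  by (intro in_closed_segment_ray) (auto simp: hull_vertices_def hull_inc)

lemma edge_point:
  assumes "c \<in> P" "d \<in> P" "0 \<le> t" "t \<le> 1"
  shows "(1 - t) *\<^sub>R c + t *\<^sub>R d \<in> convex hull {c, d}"
    "(1 - t) *\<^sub>R c + t *\<^sub>R d \<in> convex hull P"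
proof -
  show 1: "(1 - t) *\<^sub>R c + t *\<^sub>R d \<in> convex hull {c, d}"
    using assms by (auto simp: in_segment simp flip: segment_convex_hull)
  have "convex hull {c, d} \<subseteq> convex hull P" using assms by (intro hull_mono) auto
  with 1 show "(1 - t) *\<^sub>R c + t *\<^sub>R d \<in> convex hull P" by blast
qed

text \<open>Otherwise an edge avoiding \<open>x\<close>, \<open>a\<close>, \<open>b\<close> leaves
  the open cone at \<open>x\<close> spanned by \<open>a\<close> and \<open>b\<close>. It does so on
  a bounding ray and within the hull, hence on one of the segments from \<open>x\<close> to
  \<open>a\<close> and \<open>b\<close>, against visibility.\<close>

lemma cone_of_two_hull_vertices:
  assumes x: "x \<in> P" and a: "a \<in> hull_vertices P" and b: "b \<in> hull_vertices P"
    and ne: "x \<noteq> a" "x \<noteq> b" "a \<noteq> b" and sees: "sees x a" "sees x b"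
    and p: "p \<in> P - {x, a, b}" and q: "q \<in> P - {x, a, b}"
    and inside: "coord x a b p > 0" "coord x b a p > 0"
  shows "coord x a b q > 0 \<and> coord x b a q > 0"
proof (rule ccontr)
  assume "\<not> ?thesis"
  moreover have abP: "a \<in> P" "b \<in> P" using a b by (auto simp: hull_vertices_def)
  moreover have "{x, a, b} \<subseteq> P" "card {x, a, b} = 3" using x abP ne by auto
  ultimately obtain c d where cd: "c \<in> P - {x, a, b}" "d \<in> P - {x, a, b}" "{c, d} \<in> E"
    "coord x a b c > 0 \<and> coord x b a c > 0" "\<not> (coord x a b d > 0 \<and> coord x b a d > 0)"
    using crossing_edge[of "{x, a, b}" p q "\<lambda>p. coord x a b p > 0 \<and> coord x b a p > 0"]
      p q inside by metis
  obtain t where t: "0 < t" "t \<le> 1"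
    and nn: "(1 - t) * coord x a b c + t * coord x a b d \<ge> 0"
      "(1 - t) * coord x b a c + t * coord x b a d \<ge> 0"
    and root: "(1 - t) * coord x a b c + t * coord x a b d = 0 \<or> (1 - t) * coord x b a c + t * coord x b a d = 0"
    using min_affine_root[of "coord x a b c" "coord x b a c" "coord x a b d" "coord x b a d"] cd(4,5)
    by (auto simp: not_less)
  define y where "y = (1 - t) *\<^sub>R c + t *\<^sub>R d"
  have y: "y \<in> convex hull {c, d}" "y \<in> convex hull P"
    using edge_point[of c d t] cd t by (auto simp: y_def)
  have exp: "y = x + coord x a b y *\<^sub>R (a - x) + coord x b a y *\<^sub>R (b - x)"
    using frame_expansion cross2_nonzero x abP ne by metis
  have nn: "coord x a b y \<ge> 0" "coord x b a y \<ge> 0" and root: "coord x a b y = 0 \<or> coord x b a y = 0"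
    using nn root by (simp_all add: y_def coord_convex)
  have "y \<in> closed_segment x a \<or> y \<in> closed_segment x b"
    using root
  proof
    assume "coord x a b y = 0"
    then have "y = x + coord x b a y *\<^sub>R (b - x)" using exp by simp
    then show ?thesis using hull_vertex_ray_in_segment[OF b x ne(2) nn(2)] y(2) by metis
  next
    assume "coord x b a y = 0"
    then have "y = x + coord x a b y *\<^sub>R (a - x)" using exp by simp
    then show ?thesis using hull_vertex_ray_in_segment[OF a x ne(1) nn(1)] y(2) by metis
  qed
  then show False using sees cd y(1) unfolding sees_def by fastforce
qed

text \<open>The sum of the two coordinates is affine and vanishes at \<open>x\<close>. Positive on
  all other points, it would be positive on their hull, which contains the non-extreme point
  \<open>x\<close>.\<close>

lemma not_hull_vertex_not_positive:
  assumes x: "x \<in> P - hull_vertices P"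
  shows "\<not> (\<forall>p\<in>P - {x}. coord x a b p + coord x b a p > 0)"
proof
  assume *: "\<forall>p\<in>P - {x}. coord x a b p + coord x b a p > 0"
  define H where "H = {p. coord x a b p + coord x b a p > 0}"
  have "convex H"
    unfolding convex_alt
  proof (intro ballI allI impI)
    fix p q and t :: real assume "p \<in> H" "q \<in> H" and t: "0 \<le> t \<and> t \<le> 1"
    then have pq: "coord x a b p + coord x b a p > 0" "coord x a b q + coord x b a q > 0"
      by (auto simp: H_def)
    have "(1 - t) * (coord x a b p + coord x b a p) + t * (coord x a b q + coord x b a q) > 0"
    proof (cases "t = 0")
      case False
      then show ?thesis using t pq by (intro add_nonneg_pos) auto
    qed (use pq in auto)
    then show "(1 - t) *\<^sub>R p + t *\<^sub>R q \<in> H"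
      unfolding H_def mem_Collect_eq coord_convex by (simp add: algebra_simps)
  qed
  then have "convex hull (P - {x}) \<subseteq> H" using * by (intro hull_minimal) (auto simp: H_def)
  moreover have "x \<in> convex hull (P - {x})"
    using hull_verticesI[OF finite_P, of x] x by blast
  ultimately show False by (auto simp: H_def)
qed

text \<open>General position moves \<open>p\<close> from the closed cone into the open one, and all
  other points follow. As the coordinates of \<open>a\<close> and of \<open>b\<close> sum to 1, the
  sum would be positive on \<open>P - {x}\<close>.\<close>

lemma outside_cone_of_two_hull_vertices:
  assumes x: "x \<in> P - hull_vertices P" and a: "a \<in> hull_vertices P" and b: "b \<in> hull_vertices P"
    and "a \<noteq> b" and sees: "sees x a" "sees x b" and p: "p \<in> P - {x, a, b}"
  shows "\<not> (coord x a b p \<ge> 0 \<and> coord x b a p \<ge> 0)"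
proof
  assume p_in: "coord x a b p \<ge> 0 \<and> coord x b a p \<ge> 0"
  have ne: "x \<noteq> a" "x \<noteq> b" and abP: "a \<in> P" "b \<in> P" using x a b by (auto simp: hull_vertices_def)
  have "cross2 (p - x) (a - x) \<noteq> 0" "cross2 (p - x) (b - x) \<noteq> 0" "cross2 (a - x) (b - x) \<noteq> 0" "cross2 (b - x) (a - x) \<noteq> 0"
    using p x ne abP \<open>a \<noteq> b\<close> by (auto simp: cross2_nonzero)
  then have pos: "coord x a b p > 0" "coord x b a p > 0" and one: "coord x a b a = 1" "coord x b a b = 1"
    using p_in by (auto simp: coord_def less_le)
  have "\<forall>q\<in>P - {x, a, b}. coord x a b q > 0 \<and> coord x b a q > 0"
    using cone_of_two_hull_vertices[OF _ a b ne \<open>a \<noteq> b\<close> sees p _ pos] x by blast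
  then have "\<forall>q\<in>P - {x}. coord x a b q + coord x b a q > 0"
    using one by (metis Diff_iff add_pos_pos coord_second add.right_neutral add.left_neutral insertCI insertE empty_iff zero_less_one)
  then show False using not_hull_vertex_not_positive[OF x] by blast
qed

text \<open>Each closed cone at \<open>x\<close> spanned by two of \<open>a\<close>,
  \<open>b\<close>, \<open>c\<close> misses the third, so the three surround \<open>x\<close> and
  their cones cover the plane. One cone then contains a fifth point \<open>d\<close>, which is
  excluded as well.\<close>

lemma not_sees_three_hull_vertices:
  assumes x: "x \<in> P - hull_vertices P"
    and a: "a \<in> hull_vertices P" and b: "b \<in> hull_vertices P" and c: "c \<in> hull_vertices P"
    and ne: "a \<noteq> b" "b \<noteq> c" "a \<noteq> c" and sees: "sees x a" "sees x b" "sees x c"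
  shows False
proof -
  have abcP: "a \<in> P" "b \<in> P" "c \<in> P" and xne: "x \<noteq> a" "x \<noteq> b" "x \<noteq> c" and xP: "x \<in> P"
    using x a b c by (auto simp: hull_vertices_def)
  have "\<not> P \<subseteq> {x, a, b, c}"
  proof
    assume "P \<subseteq> {x, a, b, c}"
    then have "card P \<le> card {x, a, b, c}" by (intro card_mono) auto
    also have "\<dots> \<le> 4" by (simp add: card_insert_if)
    finally show False using card_P by simp
  qed
  then obtain d where d: "d \<in> P" "d \<noteq> x" "d \<noteq> a" "d \<noteq> b" "d \<noteq> c" by blast
  \<comment> \<open>Orientations as seen from \<open>x\<close>: \<open>p\<close>, \<open>q\<close>,
    \<open>r\<close> of the cyclic pairs among \<open>a\<close>, \<open>b\<close>, \<open>c\<close>,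
    and \<open>i\<close>, \<open>j\<close>, \<open>k\<close> of each of these with
    \<open>d\<close>.\<close>
  define p q r i j k where "p = cross2 (a - x) (b - x)" and "q = cross2 (b - x) (c - x)" and "r = cross2 (c - x) (a - x)"
    and "i = cross2 (a - x) (d - x)" and "j = cross2 (b - x) (d - x)" and "k = cross2 (c - x) (d - x)"
  note defs = p_def q_def r_def i_def j_def k_def
  have nz: "p \<noteq> 0" "q \<noteq> 0" "r \<noteq> 0" "i \<noteq> 0" "j \<noteq> 0" "k \<noteq> 0"
    unfolding defs using d xP abcP ne xne by (auto simp: cross2_nonzero)
  have sw: "cross2 (b - x) (a - x) = - p" "cross2 (c - x) (b - x) = - q" "cross2 (a - x) (c - x) = - r"
    "cross2 (d - x) (a - x) = - i" "cross2 (d - x) (b - x) = - j" "cross2 (d - x) (c - x) = - k"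
    unfolding defs by (simp_all add: cross2_def algebra_simps)
  note out = outside_cone_of_two_hull_vertices[OF x]
  have abc: "\<not> (- q / p \<ge> 0 \<and> r / - p \<ge> 0)"
    using out[OF a b ne(1) sees(1,2), of c] abcP xne ne unfolding coord_def sw by (auto simp: defs)
  have bca: "\<not> (- r / q \<ge> 0 \<and> p / - q \<ge> 0)"
    using out[OF b c ne(2) sees(2,3), of a] abcP xne ne unfolding coord_def sw by (auto simp: defs)
  have cab: "\<not> (- p / r \<ge> 0 \<and> q / - r \<ge> 0)"
    using out[OF c a _ sees(3,1), of b] abcP xne ne unfolding coord_def sw by (auto simp: defs)
  have abd: "\<not> (- j / p \<ge> 0 \<and> - i / - p \<ge> 0)"
    using out[OF a b ne(1) sees(1,2), of d] d unfolding coord_def sw by (auto simp: defs)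
  have bcd: "\<not> (- k / q \<ge> 0 \<and> - j / - q \<ge> 0)"
    using out[OF b c ne(2) sees(2,3), of d] d unfolding coord_def sw by (auto simp: defs)
  have cad: "\<not> (- i / r \<ge> 0 \<and> - k / - r \<ge> 0)"
    using out[OF c a _ sees(3,1), of d] d ne unfolding coord_def sw by (auto simp: defs)
  \<comment> \<open>The three-term Pluecker relation of four plane vectors; it fails if
    \<open>p\<close>, \<open>q\<close>, \<open>r\<close> share a sign and \<open>i\<close>,
    \<open>j\<close>, \<open>k\<close> do too.\<close>
  have pluecker: "p * k + q * i + r * j = 0"
    unfolding defs by (simp add: cross2_def algebra_simps)
  have sgn: "p > 0 \<and> q > 0 \<and> r > 0 \<or> p < 0 \<and> q < 0 \<and> r < 0"
    using quotients_not_both_nonneg[OF abc] quotients_not_both_nonneg[OF bca] quotients_not_both_nonneg[OF cab] nz by linarith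
  then have "i > 0 \<and> j > 0 \<and> k > 0 \<or> i < 0 \<and> j < 0 \<and> k < 0"
    using quotients_not_both_nonneg[OF abd] quotients_not_both_nonneg[OF bcd] quotients_not_both_nonneg[OF cad] nz by linarith
  with sgn have "(p * k > 0 \<and> q * i > 0 \<and> r * j > 0) \<or> (p * k < 0 \<and> q * i < 0 \<and> r * j < 0)"
    by (elim disjE conjE) (simp_all add: mult_neg_neg mult_neg_pos mult_pos_neg)
  then show False using pluecker by auto
qed

text \<open>If points lay on both sides of the chord \<open>u x\<close>, some edge avoiding
  \<open>u\<close> and \<open>x\<close> would cross its line. The crossing lies in the hull, hence
  on the chord because both ends are extreme; but \<open>u\<close> sees \<open>x\<close>.\<close>

lemma hull_chord_one_side:
  assumes u: "u \<in> hull_vertices P" and x: "x \<in> hull_vertices P" and "u \<noteq> x" and sees: "sees u x"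
    and p: "p \<in> P - {u, x}" and q: "q \<in> P - {u, x}" and pos: "cross2 (x - u) (p - u) > 0"
  shows "cross2 (x - u) (q - u) > 0"
proof (rule ccontr)
  assume neg: "\<not> ?thesis"
  have uxP: "u \<in> P" "x \<in> P" using u x by (auto simp: hull_vertices_def)
  have "\<not> P \<subseteq> {u, x, p, q}"
  proof
    assume "P \<subseteq> {u, x, p, q}"
    then have "card P \<le> card {u, x, p, q}" by (intro card_mono) auto
    also have "\<dots> \<le> 4" by (simp add: card_insert_if)
    finally show False using card_P by simp
  qed
  \<comment> \<open>Pads the cut \<open>u\<close>, \<open>x\<close> to exactly three points while
    keeping \<open>p\<close> and \<open>q\<close>.\<close>
  then obtain w where w: "w \<in> P" "w \<noteq> u" "w \<noteq> x" "w \<noteq> p" "w \<noteq> q" by blast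
  obtain c d where cd: "c \<in> P - {u, x, w}" "d \<in> P - {u, x, w}" "{c, d} \<in> E"
    "cross2 (x - u) (c - u) > 0" "\<not> cross2 (x - u) (d - u) > 0"
    using crossing_edge[of "{u, x, w}" p q "\<lambda>p. cross2 (x - u) (p - u) > 0"] w uxP p q neg pos \<open>u \<noteq> x\<close>
    by (auto simp: card_insert_if)
  have dn: "cross2 (x - u) (d - u) < 0"
    using cross2_nonzero[of u x d] cd uxP \<open>u \<noteq> x\<close> by fastforce
  define A B where "A = cross2 (x - u) (c - u)" and "B = cross2 (x - u) (d - u)"
  have AB: "A > 0" "B < 0" using cd dn by (auto simp: A_def B_def)
  define t where "t = A / (A - B)"
  have t: "0 \<le> t" "t \<le> 1" using AB by (auto simp: t_def field_simps)
  define y where "y = (1 - t) *\<^sub>R c + t *\<^sub>R d"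
  have y: "y \<in> convex hull {c, d}" "y \<in> convex hull P"
    using edge_point[of c d t] cd t by (auto simp: y_def)
  have "cross2 (x - u) (y - u) = (1 - t) * A + t * B"
    by (simp add: y_def A_def B_def cross2_def algebra_simps)
  also have "\<dots> = 0" using AB by (simp add: t_def field_simps)
  finally have "collinear {u, x, y}" by (simp add: cross2_eq_0_iff_collinear)
  then obtain r where r: "y = u + r *\<^sub>R (x - u)"
    using collinear_3_affine_hull[OF \<open>u \<noteq> x\<close>] by (auto simp: affine_hull_2_alt)
  have "y \<in> closed_segment u x"
  proof (cases "r \<ge> 0")
    case True
    then show ?thesis
      using hull_vertex_ray_in_segment[OF x uxP(1) \<open>u \<noteq> x\<close>, of r] r y(2) by simp
  next
    case False
    have "y = x + (1 - r) *\<^sub>R (u - x)" by (simp add: r algebra_simps)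
    then show ?thesis
      using hull_vertex_ray_in_segment[OF u uxP(2) \<open>u \<noteq> x\<close>[symmetric], of "1 - r"] False y(2)
      by (simp add: closed_segment_commute)
  qed
  then show False using sees cd y(1) unfolding sees_def by fastforce
qed

lemma hull_chord_same_side:
  assumes u: "u \<in> hull_vertices P" and x: "x \<in> hull_vertices P" and ux: "u \<noteq> x" and sees: "sees u x"
    and p: "p \<in> P - {u, x}" and q: "q \<in> P - {u, x}"
  shows "cross2 (x - u) (p - u) * cross2 (x - u) (q - u) > 0"
proof (cases "cross2 (x - u) (p - u) > 0")
  case True
  then show ?thesis using hull_chord_one_side[OF u x ux sees p q] by simp
next
  case False
  have flip: "cross2 (u - x) (w - x) = - cross2 (x - u) (w - u)" for w
    by (simp add: cross2_def algebra_simps)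
  have "cross2 (x - u) (p - u) \<noteq> 0"
    using cross2_nonzero[of u x p] u x ux p by (auto simp: hull_vertices_def)
  with False have neg: "cross2 (x - u) (p - u) < 0" by simp
  then have "cross2 (x - u) (q - u) < 0"
    using hull_chord_one_side[OF x u, of p q] ux sees p q
    by (auto simp: flip sees_commute insert_commute)
  with neg show ?thesis by (rule mult_neg_neg)
qed

section \<open>Visible points: apexes of hull edges and points of a half-plane\<close>

lemma edge_at:
  assumes "e \<in> E" "p \<in> e"
  obtains q where "e = {p, q}" "q \<noteq> p" "q \<in> P"
proof -
  obtain c d where cd: "e = {c, d}" "c \<noteq> d" "c \<in> P" "d \<in> P" using edgeE assms(1) by metis
  then consider "p = c" | "p = d" using assms(2) by blast
  then show ?thesis
  proof cases
    case 1
    then show ?thesis using that[of d] cd by simp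
  next
    case 2
    then show ?thesis using that[of c] cd by (simp add: insert_commute)
  qed
qed

text \<open>An affine function on a segment is nowhere below both end values; the ends are named so
  that one with value at most \<open>f z\<close> comes first.\<close>

lemma edge_descend:
  fixes f :: "point \<Rightarrow> real"
  assumes "e \<in> E" "z \<in> convex hull e"
    and f: "\<And>t p q. f ((1 - t) *\<^sub>R p + t *\<^sub>R q) = (1 - t) * f p + t * f q"
  obtains c d t where "e = {c, d}" "c \<in> P" "d \<in> P" "0 \<le> t" "t \<le> 1"
    "z = (1 - t) *\<^sub>R c + t *\<^sub>R d" "f c \<le> f z"
proof -
  obtain c d where cd: "e = {c, d}" "c \<in> P" "d \<in> P" using edgeE assms(1) by metis
  obtain t where t: "0 \<le> t" "t \<le> 1" "z = (1 - t) *\<^sub>R c + t *\<^sub>R d"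
    using assms(2) by (auto simp: cd in_segment simp flip: segment_convex_hull)
  show ?thesis
  proof (cases "f c \<le> f z")
    case True
    then show ?thesis using that[of c d t] cd t by simp
  next
    case False
    have "f d \<le> f z"
    proof (rule ccontr)
      assume "\<not> f d \<le> f z"
      then have "f z < min (f c) (f d)" using False by simp
      also have "\<dots> \<le> (1 - t) * f c + t * f d"
        using t mult_left_mono[of "min (f c) (f d)" "f c" "1 - t"]
          mult_left_mono[of "min (f c) (f d)" "f d" t] by (simp add: algebra_simps)
      also have "\<dots> = f z" by (simp add: t(3) f)
      finally show False by simp
    qed
    then show ?thesis using that[of d c "1 - t"] cd t by (auto simp: insert_commute add.commute)
  qed
qed

text \<open>The chosen point spans with \<open>u v\<close> a triangle free of other points, so
  \<open>v\<close> sees it too. If it were a hull vertex, the chords to \<open>u\<close> and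
  \<open>v\<close> would confine all other points to that empty triangle.\<close>

lemma hull_edge_apex:
  assumes u: "u \<in> hull_vertices P" and v: "v \<in> hull_vertices P" and uv: "u \<noteq> v"
    and nuv: "n \<bullet> v = n \<bullet> u" and above: "\<And>p. p \<in> P - {u, v} \<Longrightarrow> n \<bullet> u < n \<bullet> p"
  obtains x where "x \<in> P - hull_vertices P" "sees u x" "sees v x"
proof -
  have uP: "u \<in> P" and vP: "v \<in> P" using u v by (auto simp: hull_vertices_def)
  define U where "U = {p \<in> P - {u, v}. sees u p}"
  have "U \<noteq> {}"
  proof -
    have "card (P - {u, v}) \<ge> 3" using card_P uP vP uv finite_P by (simp add: card_Diff_subset)
    then obtain T where "T \<subseteq> P - {u, v}" "card T = 3" by (metis obtain_subset_with_card_n)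
    then obtain w w' q where w: "w \<in> P - {u, v}" "w' \<in> P - {u, v}" "q \<in> P - {u, v}"
      "w \<noteq> w'" "w' \<noteq> q" "w \<noteq> q" by (auto simp: card_3_iff)
    \<comment> \<open>Removing \<open>v\<close>, \<open>w\<close>, \<open>w'\<close> leaves
      \<open>u\<close> joined to \<open>q\<close>, so \<open>u\<close> has a neighbour other than
      \<open>v\<close>.\<close>
    have "{v, w, w'} \<subseteq> P" "card {v, w, w'} = 3" "u \<in> P - {v, w, w'}" "q \<in> P - {v, w, w'}" "q \<noteq> u"
      using w uP vP uv by auto
    then obtain d where "d \<in> P - {v, w, w'}" "{u, d} \<in> E" "d \<noteq> u"
      using crossing_edge[of "{v, w, w'}" u q "\<lambda>p. p = u"] by metis
    then have "d \<in> U" by (auto simp: U_def edge_sees)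
    then show ?thesis by blast
  qed
  \<comment> \<open>\<open>\<omega> p\<close> is the cotangent of the angle at \<open>u\<close> between \<open>v\<close> and \<open>p\<close>, up to a positive
    factor: the apex is the point seen from \<open>u\<close> with the smallest angle.\<close>
  define \<omega> where "\<omega> p = ((v - u) \<bullet> (p - u)) / (n \<bullet> (p - u))" for p
  have "finite U" using finite_P by (simp add: U_def)
  then obtain x where x: "x \<in> U" and xmax: "\<And>w. w \<in> U \<Longrightarrow> \<omega> w \<le> \<omega> x"
    using finite_has_maximizer[of U \<omega>] \<open>U \<noteq> {}\<close> by blast
  have xP: "x \<in> P" and xne: "x \<noteq> u" "x \<noteq> v" and seesx: "sees u x" using x by (auto simp: U_def)
  \<comment> \<open>In the frame at \<open>u\<close>, the triangle \<open>u v x\<close> is given by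
    \<open>l \<ge> 0\<close>, \<open>m \<ge> 0\<close> and \<open>f \<le> 1\<close>; the line
    through \<open>v\<close> and \<open>x\<close> is \<open>f = 1\<close>.\<close>
  define l m where "l = coord u v x" and "m = coord u x v"
  define f where "f p = l p + m p" for p
  have crs: "cross2 (v - u) (x - u) \<noteq> 0" "cross2 (x - u) (v - u) \<noteq> 0" using uP vP xP xne uv by (simp_all add: cross2_nonzero)
  have expand: "p = u + l p *\<^sub>R (v - u) + m p *\<^sub>R (x - u)" for p
    unfolding l_def m_def using frame_expansion[OF crs(1)] by simp
  have aff: "l ((1 - t) *\<^sub>R p + t *\<^sub>R q) = (1 - t) * l p + t * l q"
    "m ((1 - t) *\<^sub>R p + t *\<^sub>R q) = (1 - t) * m p + t * m q"
    "f ((1 - t) *\<^sub>R p + t *\<^sub>R q) = (1 - t) * f p + t * f q" for t p q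
    unfolding f_def l_def m_def coord_convex by (simp_all add: algebra_simps)
  have at: "l u = 0" "m u = 0" "l v = 1" "m v = 0" "l x = 0" "m x = 1"
    using crs by (simp_all add: l_def m_def)
  have nx: "n \<bullet> (x - u) > 0" using above[of x] xP xne by (simp add: inner_diff_right)
  have n_eq: "n \<bullet> (p - u) = m p * (n \<bullet> (x - u))" for p
  proof -
    have "p - u = l p *\<^sub>R (v - u) + m p *\<^sub>R (x - u)" using expand[of p] by (simp add: algebra_simps)
    then have "n \<bullet> (p - u) = l p * (n \<bullet> (v - u)) + m p * (n \<bullet> (x - u))"
      by (simp only: inner_add_right inner_scaleR_right)
    then show ?thesis using nuv by (simp add: inner_diff_right)
  qed
  have m_pos: "m p > 0" if "p \<in> P - {u, v}" for p
  proof -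
    have "m p * (n \<bullet> (x - u)) > 0" using above[OF that] n_eq[of p] by (simp add: inner_diff_right)
    then show ?thesis using nx by (simp add: zero_less_mult_iff)
  qed
  have l_nz: "l p \<noteq> 0" if "p \<in> P - {u, x}" for p
    using that cross2_nonzero[of u p x] crs uP xP xne by (auto simp: l_def coord_def)
  \<comment> \<open>\<open>\<omega> w - \<omega> x\<close> has the sign of \<open>l w\<close>, so by
    maximality no point seen from \<open>u\<close> lies strictly on the side of
    \<open>v\<close>.\<close>
  have l_le: "l w \<le> 0" if w: "w \<in> U" for w
  proof -
    have wP: "w \<in> P - {u, v}" using w by (simp add: U_def)
    have "w - u = l w *\<^sub>R (v - u) + m w *\<^sub>R (x - u)" using expand[of w] by (simp add: algebra_simps)
    then have 1: "(v - u) \<bullet> (w - u) = l w * ((v - u) \<bullet> (v - u)) + m w * ((v - u) \<bullet> (x - u))"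
      by (simp only: inner_add_right inner_scaleR_right)
    have "\<omega> w = l w * ((v - u) \<bullet> (v - u)) / (m w * (n \<bullet> (x - u))) + \<omega> x"
      unfolding \<omega>_def n_eq[of w] 1 using m_pos[OF wP] nx by (simp add: field_simps)
    then have "l w * ((v - u) \<bullet> (v - u)) / (m w * (n \<bullet> (x - u))) \<le> 0"
      using xmax[OF w] by simp
    moreover have "m w * (n \<bullet> (x - u)) > 0" using m_pos[OF wP] nx by simp
    ultimately have "l w * ((v - u) \<bullet> (v - u)) \<le> 0" by (simp add: divide_le_0_iff)
    moreover have "(v - u) \<bullet> (v - u) > 0" using uv by simp
    ultimately show ?thesis by (simp add: mult_le_0_iff)
  qed
  \<comment> \<open>An edge from a point \<open>z\<close> of the triangle to an end \<open>c\<close>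
    across the line \<open>u x\<close> keeps \<open>m \<ge> 0\<close> and \<open>f \<le> 1\<close>
    up to that line, so it would cross the segment \<open>u x\<close>.\<close>
  have leave: False
    if "{c, d} \<in> E" and z: "z \<in> convex hull {c, d}" "l z > 0" "m z \<ge> 0" "f z \<le> 1"
      and c: "l c < 0" "m c \<ge> 0" "f c \<le> 1" and ni: "u \<notin> {c, d}" "x \<notin> {c, d}" for c d z
  proof -
    define t where "t = l z / (l z - l c)"
    have t: "0 \<le> t" "t \<le> 1" using z c by (auto simp: t_def field_simps)
    define y where "y = (1 - t) *\<^sub>R z + t *\<^sub>R c"
    have "c \<in> convex hull {c, d}" by (simp add: hull_inc)
    then have y: "y \<in> convex hull {c, d}"
      using convexD_alt[OF convex_convex_hull z(1) _ t] by (simp add: y_def)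
    have "l y = (1 - t) * l z + t * l c" by (simp add: y_def aff)
    also have "\<dots> = 0" using z c by (simp add: t_def field_simps)
    finally have "l y = 0" .
    moreover have "m y \<ge> 0" using z c t by (simp add: y_def aff)
    moreover have "f y \<le> 1"
      using convex_bound_le[of "f z" 1 "f c" "1 - t" t] z c t by (simp add: y_def aff)
    ultimately have "y \<in> closed_segment u x"
      using expand[of y] in_closed_segment_ray[of "m y" u x] by (simp add: f_def)
    moreover have "convex hull {c, d} \<inter> closed_segment u x = {}"
      using seesx that(1) ni unfolding sees_def by (metis (no_types))
    ultimately show False using y by auto
  qed
  define T where "T = {p \<in> P - {u, v, x}. l p \<ge> 0 \<and> f p \<le> 1}"
  have notT: "l c < 0" if "c \<in> P - {u, v, x}" "c \<notin> T" "f c \<le> 1" for c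
    using that l_nz[of c] by (auto simp: T_def)
  have "T = {}"
  proof (rule ccontr)
    assume "T \<noteq> {}"
    moreover have "finite T" using finite_P by (simp add: T_def)
    \<comment> \<open>With \<open>f a\<close> minimal, an edge hiding \<open>a\<close> from
      \<open>u\<close> has an end with smaller \<open>f\<close>, hence outside \<open>T\<close> and
      across \<open>u x\<close>, which \<open>leave\<close> excludes. So \<open>u\<close> sees
      \<open>a\<close>, against \<open>l_le\<close>.\<close>
    ultimately obtain a where a: "a \<in> T" and "\<And>p. p \<in> T \<Longrightarrow> - f p \<le> - f a"
      using finite_has_maximizer[of T "\<lambda>p. - f p"] by blast
    then have amin: "\<And>p. p \<in> T \<Longrightarrow> f a \<le> f p" by simp
    have aP: "a \<in> P - {u, v, x}" "l a > 0" "m a > 0" "f a \<le> 1"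
      using a l_nz[of a] m_pos[of a] by (auto simp: T_def less_le)
    have "sees u a"
      unfolding sees_def
    proof (intro ballI impI equals0I)
      fix e z assume e: "e \<in> E" "u \<notin> e" "a \<notin> e" and z: "z \<in> convex hull e \<inter> closed_segment u a"
      then obtain r where r: "0 \<le> r" "r \<le> 1" "z = (1 - r) *\<^sub>R u + r *\<^sub>R a" by (auto simp: in_segment)
      have "z \<noteq> a" "z \<noteq> u" using edge_hull_Int_P[OF e(1)] e z aP uP by blast+
      then have r': "0 < r" "r < 1" using r by (auto simp: less_le)
      have lz: "l z > 0" "m z > 0" "f z < f a"
        using r r' aP by (simp_all add: r aff at f_def) (simp add: mult_less_cancel_right1 flip: distrib_left)
      obtain c d t where cd: "e = {c, d}" "c \<in> P" "d \<in> P" and t: "0 \<le> t" "t \<le> 1"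
        "z = (1 - t) *\<^sub>R c + t *\<^sub>R d" and fc: "f c \<le> f z"
        using edge_descend[of e z f] e z aff(3) by blast
      have "c \<notin> T" using amin fc lz by fastforce
      moreover have "c \<in> P - {u, v, x}"
        using cd e fc lz aP by (auto simp: f_def at)
      ultimately have c: "l c < 0" "m c > 0" using notT m_pos[of c] fc lz aP by auto
      have "x \<noteq> d"
      proof
        assume "x = d"
        have "l z = (1 - t) * l c + t * l d" by (simp only: t(3) aff)
        then have "l z = (1 - t) * l c" using \<open>x = d\<close> at by simp
        then show False using lz c t by (simp add: zero_less_mult_iff)
      qed
      moreover have "x \<noteq> c" using c at by auto
      ultimately show False using leave[of c d z] e z cd lz c fc aP by auto
    qed
    then have "a \<in> U" using aP by (auto simp: U_def)
    then show False using l_le aP by fastforce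
  qed
  have "sees v x"
    unfolding sees_def
  proof (intro ballI impI equals0I)
    fix e z assume e: "e \<in> E" "v \<notin> e" "x \<notin> e" and z: "z \<in> convex hull e \<inter> closed_segment v x"
    then obtain r where r: "0 \<le> r" "r \<le> 1" "z = (1 - r) *\<^sub>R v + r *\<^sub>R x" by (auto simp: in_segment)
    have "z \<noteq> v" "z \<noteq> x" using edge_hull_Int_P[OF e(1)] e z vP xP by blast+
    then have r': "0 < r" "r < 1" using r by (auto simp: less_le)
    then have lz: "l z > 0" "m z > 0" "f z = 1" by (simp_all add: r aff at f_def)
    \<comment> \<open>If the blocking edge starts at \<open>u\<close>, its other end is seen from
      \<open>u\<close> and has \<open>l \<le> 0\<close>; otherwise its end with smaller
      \<open>f\<close> lies across \<open>u x\<close> because \<open>T\<close> is empty.\<close>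
    show False
    proof (cases "u \<in> e")
      case True
      obtain d where d: "e = {u, d}" "d \<noteq> u" "d \<in> P" using edge_at[OF e(1) True] .
      then have "d \<in> U" using e by (auto simp: U_def edge_sees)
      then have "l d \<le> 0" by (rule l_le)
      obtain t where t: "0 \<le> t" "t \<le> 1" "z = (1 - t) *\<^sub>R u + t *\<^sub>R d"
        using z by (auto simp: d in_segment simp flip: segment_convex_hull)
      then have "l z = t * l d" by (simp add: aff at)
      then show False using lz t \<open>l d \<le> 0\<close> by (simp add: zero_less_mult_iff)
    next
      case False
      obtain c d t where cd: "e = {c, d}" "c \<in> P" "d \<in> P" and t: "0 \<le> t" "t \<le> 1"
        "z = (1 - t) *\<^sub>R c + t *\<^sub>R d" and fc: "f c \<le> f z"
        using edge_descend[of e z f] e z aff(3) by blast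
      have "c \<in> P - {u, v, x}" using cd e False by auto
      then have c: "l c < 0" "m c > 0" using notT m_pos[of c] fc lz \<open>T = {}\<close> by auto
      then show False using leave[of c d z] e z cd lz fc False by auto
    qed
  qed
  moreover have "x \<notin> hull_vertices P"
  proof
    assume xh: "x \<in> hull_vertices P"
    have "\<not> P \<subseteq> {u, v, x}"
    proof
      assume "P \<subseteq> {u, v, x}"
      then have "card P \<le> card {u, v, x}" by (intro card_mono) auto
      also have "\<dots> \<le> 3" by (simp add: card_insert_if)
      finally show False using card_P by simp
    qed
    \<comment> \<open>Both chords leave \<open>p\<close> on the side of the third corner, which
      would put it into \<open>T\<close>.\<close>
    then obtain p where p: "p \<in> P - {u, v, x}" by blast
    define V X where "V = v - u" and "X = x - u"
    have pu: "p - u = l p *\<^sub>R V + m p *\<^sub>R X" using expand[of p] by (simp add: V_def X_def algebra_simps)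
    have "cross2 (x - u) (p - u) * cross2 (x - u) (v - u) = l p * (cross2 X V)\<^sup>2"
      unfolding pu V_def[symmetric] X_def[symmetric]
      by (simp add: cross2_def power2_eq_square algebra_simps)
    moreover have "cross2 (x - u) (p - u) * cross2 (x - u) (v - u) > 0"
      using hull_chord_same_side[OF u xh _ seesx, of p v] p vP uv xne by auto
    ultimately have "l p > 0" by (simp add: zero_less_mult_iff)
    have "cross2 (x - v) (p - v) = (1 - f p) * - cross2 X V"
    proof -
      have eq: "x - v = X - V" "p - v = l p *\<^sub>R V + m p *\<^sub>R X - V" using pu by (simp_all add: V_def X_def algebra_simps)
      show ?thesis unfolding eq by (simp add: f_def cross2_def algebra_simps)
    qed
    moreover have "cross2 (x - v) (u - v) = - cross2 X V"
      by (simp add: V_def X_def cross2_def algebra_simps)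
    ultimately have "cross2 (x - v) (p - v) * cross2 (x - v) (u - v) = (1 - f p) * (cross2 X V)\<^sup>2"
      by (simp add: power2_eq_square)
    moreover have "cross2 (x - v) (p - v) * cross2 (x - v) (u - v) > 0"
      using hull_chord_same_side[OF v xh _ \<open>sees v x\<close>, of p u] p uP uv xne by auto
    ultimately have "f p < 1" by (simp add: zero_less_mult_iff)
    with \<open>l p > 0\<close> p have "p \<in> T" by (simp add: T_def)
    then show False using \<open>T = {}\<close> by simp
  qed
  ultimately show ?thesis using that xP seesx by blast
qed

text \<open>A blocked view of \<open>s\<close> is replaced by the view of a point in a triangle
  whose corners all lie in the closed half-plane at \<open>t\<close>. This later yields a removed
  point seen by a new hull vertex.\<close>

lemma sees_point_above:
  assumes tP: "t \<in> P" and sP: "s \<in> P" and st: "s \<noteq> t" and ns: "n \<bullet> t \<le> n \<bullet> s"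
  obtains s' where "s' \<in> P" "s' \<noteq> t" "n \<bullet> t \<le> n \<bullet> s'" "sees t s'"
proof (cases "sees t s")
  case True
  then show ?thesis using that assms by blast
next
  case False
  \<comment> \<open>Let \<open>y\<close> be the crossing on the segment \<open>t s\<close> closest to \<open>t\<close> and \<open>c\<close> the upper end of the edge
    through \<open>y\<close>. In the triangle \<open>t y c\<close>, the point of smallest angle at \<open>t\<close> with \<open>t y\<close> is seen from \<open>t\<close>.\<close>
  define K where "K = \<Union>{convex hull e |e. e \<in> E \<and> t \<notin> e \<and> s \<notin> e} \<inter> closed_segment t s"
  have "finite E"
  proof (rule finite_subset)
    show "E \<subseteq> Pow P" using edgeE by blast
  qed (simp add: finite_P)
  then have "closed K" unfolding K_def
    by (intro closed_Int closed_Union closed_segment)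
      (auto elim!: edgeE intro!: compact_imp_closed finite_imp_compact_convex_hull)
  moreover have "K \<noteq> {}" using False by (fastforce simp: K_def sees_def)
  ultimately obtain y where yK: "y \<in> K" and ymin: "\<And>w. w \<in> K \<Longrightarrow> dist t y \<le> dist t w"
    using distance_attains_inf[of K t] by metis
  obtain e where e: "e \<in> E" "t \<notin> e" "s \<notin> e" "y \<in> convex hull e" using yK by (auto simp: K_def)
  obtain \<rho> where \<rho>: "0 \<le> \<rho>" "\<rho> \<le> 1" "y = (1 - \<rho>) *\<^sub>R t + \<rho> *\<^sub>R s" using yK by (auto simp: K_def in_segment)
  have "y \<noteq> t" "y \<noteq> s" using edge_hull_Int_P[OF e(1)] e tP sP by blast+
  then have \<rho>': "0 < \<rho>" "\<rho> < 1" using \<rho> by (auto simp: less_le)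
  have yt: "y - t = \<rho> *\<^sub>R (s - t)" by (simp add: \<rho> algebra_simps)
  \<comment> \<open>By general position, edges at \<open>s\<close> meet the line \<open>t s\<close>
    only in \<open>s\<close>, beyond \<open>y\<close>; other edges avoiding \<open>t\<close> cannot
    cross before the nearest crossing \<open>y\<close>.\<close>
  have near: "r = 1" if g: "g \<in> E" "t \<notin> g" and r: "0 \<le> r" "r \<le> 1" and w: "t + r *\<^sub>R (y - t) \<in> convex hull g" for g r
  proof (cases "s \<in> g")
    case True
    obtain k where k: "g = {s, k}" "k \<noteq> s" "k \<in> P" using edge_at[OF g(1) True] .
    obtain \<tau> where \<tau>: "t + r *\<^sub>R (y - t) = (1 - \<tau>) *\<^sub>R s + \<tau> *\<^sub>R k"
      using w by (auto simp: k in_segment simp flip: segment_convex_hull)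
    have eq: "(r * \<rho>) *\<^sub>R (s - t) = (1 - \<tau>) *\<^sub>R (s - t) + \<tau> *\<^sub>R (k - t)"
      using \<tau> by (simp add: yt algebra_simps)
    have "cross2 (s - t) (k - t) \<noteq> 0" using k g tP sP st by (auto simp: cross2_nonzero)
    moreover have "cross2 (s - t) ((r * \<rho>) *\<^sub>R (s - t)) = \<tau> * cross2 (s - t) (k - t)"
      unfolding eq by (simp add: cross2_add cross2_scale)
    ultimately have "\<tau> = 0" by (simp add: cross2_scale)
    then have "r * \<rho> = 1" using eq st by (simp add: scaleR_cancel_right[of _ _ 1, simplified])
    moreover have "r * \<rho> < 1" using r \<rho>' mult_le_cancel_right2[of r \<rho>] by linarith
    ultimately show ?thesis by simp
  next
    case False
    have "t + r *\<^sub>R (y - t) = (1 - r * \<rho>) *\<^sub>R t + (r * \<rho>) *\<^sub>R s" by (simp add: yt algebra_simps)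
    moreover have "0 \<le> r * \<rho>" "r * \<rho> \<le> 1" using r \<rho> by (auto simp: mult_le_one)
    ultimately have "t + r *\<^sub>R (y - t) \<in> closed_segment t s" unfolding in_segment by blast
    then have "t + r *\<^sub>R (y - t) \<in> K" using False g w by (auto simp: K_def)
    from ymin[OF this] have "norm (y - t) \<le> r * norm (y - t)" using r by (simp add: dist_norm norm_minus_commute)
    then show ?thesis using r \<open>y \<noteq> t\<close> by (simp add: mult_le_cancel_right1)
  qed
  obtain c d \<tau> where cd: "e = {c, d}" "c \<in> P" "d \<in> P" and \<tau>: "0 \<le> \<tau>" "\<tau> \<le> 1"
    "y = (1 - \<tau>) *\<^sub>R c + \<tau> *\<^sub>R d" and nc: "- (n \<bullet> c) \<le> - (n \<bullet> y)"
    using edge_descend[of e y "\<lambda>p. - (n \<bullet> p)"] e by (auto simp: inner_add_right)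
  have offline: "y \<noteq> q" if "q \<in> P" "q \<noteq> t" "q \<noteq> s" for q
  proof
    assume "y = q"
    then have "cross2 (s - t) (q - t) = 0" using yt by (simp add: cross2_scale)
    then show False using cross2_nonzero[of t s q] that tP sP st by auto
  qed
  have ne: "c \<noteq> t" "c \<noteq> s" "d \<noteq> t" "d \<noteq> s" using cd e by auto
  have yc: "y \<noteq> c" "y \<noteq> d" using offline cd ne by auto
  have crs: "cross2 (y - t) (c - t) \<noteq> 0" "cross2 (c - t) (y - t) \<noteq> 0"
    using \<rho>' cross2_nonzero[of t s c] cross2_nonzero[of t c s] cd tP sP st ne by (auto simp: yt cross2_scale)
  define l m where "l = coord t y c" and "m = coord t c y"
  define f where "f p = l p + m p" for p
  have expand: "p = t + l p *\<^sub>R (y - t) + m p *\<^sub>R (c - t)" for p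
    unfolding l_def m_def using frame_expansion[OF crs(1)] by simp
  have aff: "l ((1 - t) *\<^sub>R p + t *\<^sub>R q) = (1 - t) * l p + t * l q"
    "m ((1 - t) *\<^sub>R p + t *\<^sub>R q) = (1 - t) * m p + t * m q"
    "f ((1 - t) *\<^sub>R p + t *\<^sub>R q) = (1 - t) * f p + t * f q" for t p q
    unfolding f_def l_def m_def coord_convex by (simp_all add: algebra_simps)
  have at: "l t = 0" "m t = 0" "l y = 1" "m y = 0" "l c = 0" "m c = 1"
    using crs by (simp_all add: l_def m_def)
  \<comment> \<open>The points of \<open>P\<close> in the triangle \<open>t y c\<close> and off the
    line \<open>t y\<close>. A larger \<open>l / m\<close> means a smaller angle at \<open>t\<close>
    with \<open>t y\<close>.\<close>
  define T where "T = {p \<in> P. l p \<ge> 0 \<and> m p > 0 \<and> f p \<le> 1}"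
  have "c \<in> T" using cd by (simp add: T_def f_def at)
  moreover have "finite T" using finite_P by (simp add: T_def)
  ultimately obtain p where p: "p \<in> T" and pmax: "\<And>q. q \<in> T \<Longrightarrow> l q / m q \<le> l p / m p"
    using finite_has_maximizer[of T "\<lambda>p. l p / m p"] by blast
  have pP: "p \<in> P" "l p \<ge> 0" "m p > 0" "f p \<le> 1" using p by (auto simp: T_def)
  then have pt: "p \<noteq> t" using at by auto
  have "n \<bullet> t \<le> n \<bullet> p"
  proof -
    have ny: "n \<bullet> (y - t) \<ge> 0" using \<rho>' ns by (simp add: yt inner_diff_right)
    then have "n \<bullet> (c - t) \<ge> 0" using nc by (simp add: inner_diff_right)
    moreover have "p - t = l p *\<^sub>R (y - t) + m p *\<^sub>R (c - t)" using expand[of p] by (simp add: algebra_simps)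
    then have "n \<bullet> (p - t) = l p * (n \<bullet> (y - t)) + m p * (n \<bullet> (c - t))"
      by (simp only: inner_add_right inner_scaleR_right)
    ultimately have "n \<bullet> (p - t) \<ge> 0" using ny pP by simp
    then show ?thesis by (simp add: inner_diff_right)
  qed
  moreover have "sees t p"
    unfolding sees_def
  proof (intro ballI impI equals0I)
    fix g z assume g: "g \<in> E" "t \<notin> g" "p \<notin> g" and z: "z \<in> convex hull g \<inter> closed_segment t p"
    then obtain r where r: "0 \<le> r" "r \<le> 1" "z = (1 - r) *\<^sub>R t + r *\<^sub>R p" by (auto simp: in_segment)
    have "z \<noteq> t" "z \<noteq> p" using edge_hull_Int_P[OF g(1)] g z tP pP by blast+
    then have r': "0 < r" "r < 1" using r by (auto simp: less_le)
    have fp: "f p > 0" using pP by (simp add: f_def)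
    have lz: "m z > 0" using r r' pP by (simp add: r aff at)
    have "f z = (1 - r) * f t + r * f p" by (simp only: r(3) aff)
    also have "\<dots> = r * f p" by (simp add: f_def at)
    also have "\<dots> < 1 * 1" using r' pP fp by (intro mult_less_le_imp_less) auto
    finally have fz: "f z < 1" by simp
    \<comment> \<open>Up to a factor the determinant of \<open>p - t\<close> and
      \<open>q - t\<close>: zero on the line \<open>t p\<close> and positive on the side of
      \<open>y\<close>. A point of \<open>T\<close> with positive \<open>h\<close> would beat the
      ratio of \<open>p\<close>.\<close>
    define h where "h q = m p * l q - l p * m q" for q
    have haff: "h ((1 - t) *\<^sub>R p + t *\<^sub>R q) = (1 - t) * h p + t * h q" for t p q
      unfolding h_def aff by (simp add: algebra_simps)
    have hz: "h z = 0" by (simp add: h_def r aff at)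
    obtain k j \<sigma> where kj: "g = {k, j}" "k \<in> P" "j \<in> P" and \<sigma>: "0 \<le> \<sigma>" "\<sigma> \<le> 1"
      "z = (1 - \<sigma>) *\<^sub>R k + \<sigma> *\<^sub>R j" and hk: "- h k \<le> - h z"
      using edge_descend[of g z "\<lambda>q. - h q"] g z haff by auto
    have "h k \<noteq> 0"
    proof
      assume "h k = 0"
      define Y C where "Y = y - t" and "C = c - t"
      have pk: "p - t = l p *\<^sub>R Y + m p *\<^sub>R C" "k - t = l k *\<^sub>R Y + m k *\<^sub>R C"
        using expand[of p] expand[of k] by (simp_all add: Y_def C_def algebra_simps)
      have "cross2 (p - t) (k - t) = - h k * cross2 Y C" unfolding pk by (simp add: h_def cross2_def algebra_simps)
      then show False using \<open>h k = 0\<close> cross2_nonzero[of t p k] tP pP pt kj g by auto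
    qed
    then have hk: "h k > 0" using hk hz by simp
    have "k \<notin> T"
    proof
      assume "k \<in> T"
      then have "l k / m k \<le> l p / m p" "m k > 0" using pmax by (auto simp: T_def)
      then have "h k \<le> 0" using pP by (simp add: h_def field_simps)
      then show False using hk by simp
    qed
    have l_pos: "l q > 0" if "h q > 0" "m q \<ge> 0" for q
    proof -
      have "l p * m q \<ge> 0" using that pP by simp
      then have "m p * l q > 0" using that by (simp add: h_def)
      then show ?thesis using pP by (simp add: zero_less_mult_iff)
    qed
    then have "m k \<le> 0 \<or> 1 - f k \<le> 0" using hk \<open>k \<notin> T\<close> kj by (force simp: T_def not_le)
    \<comment> \<open>Followed from \<open>z\<close> to \<open>k\<close>, the blocking edge leaves
      the triangle at \<open>w\<close>, on the line \<open>t y\<close> or on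
      \<open>f = 1\<close>.\<close>
    then obtain \<theta> where \<theta>: "0 < \<theta>" "\<theta> \<le> 1" and
      nn: "(1 - \<theta>) * m z + \<theta> * m k \<ge> 0" "(1 - \<theta>) * (1 - f z) + \<theta> * (1 - f k) \<ge> 0" and
      root: "(1 - \<theta>) * m z + \<theta> * m k = 0 \<or> (1 - \<theta>) * (1 - f z) + \<theta> * (1 - f k) = 0"
      using min_affine_root[of "m z" "1 - f z" "m k" "1 - f k"] lz fz by auto
    define w where "w = (1 - \<theta>) *\<^sub>R z + \<theta> *\<^sub>R k"
    have mw: "m w \<ge> 0" and fw: "f w \<le> 1" and root: "m w = 0 \<or> f w = 1"
      using nn root unfolding w_def aff by (auto simp: algebra_simps)
    have "h w > 0" using \<theta> hk hz by (simp add: w_def haff)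
    then have lw: "l w > 0" using mw by (rule l_pos)
    have "k \<in> convex hull g" using kj by (simp add: hull_inc)
    then have wg: "w \<in> convex hull g"
      unfolding w_def using convexD_alt[OF convex_convex_hull, of z g k \<theta>] z \<theta> by auto
    \<comment> \<open>On the line \<open>t y\<close>, \<open>near\<close> forces
      \<open>w = y\<close>; so in both cases \<open>w\<close> lies on the side \<open>y c\<close>, a
      part of \<open>e\<close>.\<close>
    have fw1: "f w = 1"
    proof (cases "m w = 0")
      case True
      then have "w = t + l w *\<^sub>R (y - t)" using expand[of w] by simp
      then have "l w = 1" using near[OF g(1,2), of "l w"] wg lw fw True by (simp add: f_def)
      then show ?thesis using True by (simp add: f_def)
    qed (use root in auto)
    have mw1: "m w \<le> 1" using fw1 lw by (simp add: f_def)
    have lw_eq: "l w = 1 - m w" using fw1 by (simp add: f_def)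
    have "w = t + (1 - m w) *\<^sub>R (y - t) + m w *\<^sub>R (c - t)" using expand[of w] unfolding lw_eq .
    then have w_eq: "w = (1 - m w) *\<^sub>R y + m w *\<^sub>R c" by (simp add: algebra_simps)
    have "c \<in> convex hull e" by (simp add: cd hull_inc)
    then have "(1 - m w) *\<^sub>R y + m w *\<^sub>R c \<in> convex hull e"
      using convexD_alt[OF convex_convex_hull, of y e c "m w"] e mw mw1 by auto
    then have we: "w \<in> convex hull e" using w_eq by simp
    have "\<tau> \<noteq> 0" using \<tau> yc by auto
    \<comment> \<open>The edge \<open>e\<close> lies on the line \<open>f = 1\<close>, while
      \<open>f z < 1\<close>.\<close>
    have "g \<noteq> e"
    proof
      assume "g = e"
      have "f y = (1 - \<tau>) * f c + \<tau> * f d" by (simp add: \<tau> aff)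
      then have "\<tau> * f d = \<tau> * 1" by (simp add: f_def at algebra_simps)
      then have "f d = 1" using \<open>\<tau> \<noteq> 0\<close> by simp
      moreover obtain \<sigma> where "z = (1 - \<sigma>) *\<^sub>R c + \<sigma> *\<^sub>R d"
        using z by (auto simp: \<open>g = e\<close> cd in_segment simp flip: segment_convex_hull)
      ultimately have "f z = 1" by (simp add: aff) (simp add: f_def at)
      then show False using fz by simp
    qed
    \<comment> \<open>Distinct edges share only ends, and \<open>l w > 0\<close> excludes
      \<open>c\<close>. But \<open>d\<close> lies on the other side of \<open>y\<close>, not on the
      segment from \<open>y\<close> to \<open>c\<close>.\<close>
    then have "w \<in> e" using edges_meet[OF g(1) e(1)] wg we by blast
    then have "w = d" using lw at cd by auto
    then have "(1 - m w) *\<^sub>R y + m w *\<^sub>R c = d" using w_eq by simp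
    then have "(1 - (1 - m w) * \<tau>) *\<^sub>R (d - c) = 0" unfolding \<tau>(3) by (simp add: algebra_simps)
    moreover have "d \<noteq> c" using \<tau> yc by (auto simp: algebra_simps)
    ultimately have "(1 - m w) * \<tau> = 1" by simp
    moreover have "(1 - m w) * \<tau> \<le> 1 * \<tau>" using mw \<tau> by (intro mult_right_mono) auto
    ultimately have "\<tau> = 1" using \<tau> by simp
    then show False using \<tau> yc by simp
  qed
  ultimately show ?thesis using that pP pt by blast
qed

section \<open>Removal of consecutive hull vertices and the count\<close>

lemma hull_edge_supporting:
  assumes edge: "closed_segment u v edge_of convex hull P" and uP: "u \<in> P" and vP: "v \<in> P"
  obtains n where "u \<noteq> v" "n \<bullet> v = n \<bullet> u" "\<And>p. p \<in> P - {u, v} \<Longrightarrow> n \<bullet> u < n \<bullet> p"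
proof -
  have "u \<noteq> v" using edge by (auto simp: edge_of_def)
  \<comment> \<open>Faces of a polyhedron are exposed, which provides a supporting line; general
    position keeps all further points of \<open>P\<close> off it.\<close>
  have "polyhedron (convex hull P)"
    using finite_P by (auto intro!: polytope_imp_polyhedron simp: polytope_def)
  then have "closed_segment u v exposed_face_of convex hull P"
    using edge exposed_face_of_polyhedron by (auto simp: edge_of_def)
  then obtain a b where le: "convex hull P \<subseteq> {x. a \<bullet> x \<le> b}"
    and eq: "closed_segment u v = convex hull P \<inter> {x. a \<bullet> x = b}"
    by (auto simp: exposed_face_of_def)
  have "u \<in> closed_segment u v" "v \<in> closed_segment u v" by auto
  then have uv: "a \<bullet> u = b" "a \<bullet> v = b" unfolding eq by auto
  have "(- a) \<bullet> u < (- a) \<bullet> p" if p: "p \<in> P - {u, v}" for p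
  proof -
    have pC: "p \<in> convex hull P" using p by (simp add: hull_inc)
    have "a \<bullet> p \<noteq> b"
    proof
      assume "a \<bullet> p = b"
      then have "p \<in> closed_segment u v" using pC unfolding eq by simp
      then have "collinear {u, p, v}"
        by (metis between_imp_collinear between_mem_segment insert_commute)
      then show False
        using general_positionD[OF general_position_P uP _ vP, of p] p \<open>u \<noteq> v\<close> by auto
    qed
    then show ?thesis using le pC uv by force
  qed
  then show ?thesis using that[of "- a"] \<open>u \<noteq> v\<close> uv by simp
qed

text \<open>Separation gives a closed half-plane at \<open>t\<close> without other points of
  \<open>P - S\<close>. As \<open>t\<close> lies in the hull of \<open>P - {t}\<close>, it contains
  a further point of \<open>P\<close>, hence one that \<open>t\<close> sees, and this belongs to
  \<open>S\<close>.\<close>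

lemma new_hull_vertex_sees_removed_point:
  assumes t: "t \<in> P - hull_vertices P" and S: "S \<subseteq> hull_vertices P" and tQ: "t \<in> hull_vertices (P - S)"
  obtains s where "s \<in> S" "sees t s"
proof -
  have "t \<notin> convex hull (P - S - {t})" by (rule hull_vertex_notin_hull_of_rest[OF tQ])
  moreover have "closed (convex hull (P - S - {t}))"
    using finite_P by (simp add: compact_imp_closed finite_imp_compact_convex_hull)
  ultimately obtain n b where nb: "n \<bullet> t < b" "\<And>q. q \<in> convex hull (P - S - {t}) \<Longrightarrow> n \<bullet> q > b"
    using separating_hyperplane_closed_point[of "convex hull (P - S - {t})" t] by auto
  have below: "n \<bullet> t < n \<bullet> q" if "q \<in> P - S - {t}" for q
    using nb(1) nb(2)[OF hull_inc[OF that]] by linarith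
  have "\<exists>s\<in>P - {t}. n \<bullet> s \<le> n \<bullet> t"
  proof (rule ccontr)
    assume "\<not> ?thesis"
    then have "P - {t} \<subseteq> {q. n \<bullet> q > n \<bullet> t}" by (auto simp: not_le)
    then have "convex hull (P - {t}) \<subseteq> {q. n \<bullet> q > n \<bullet> t}"
      by (intro hull_minimal) (simp_all add: convex_halfspace_gt)
    moreover have "t \<in> convex hull (P - {t})" using hull_verticesI[OF finite_P, of t] t by blast
    ultimately show False by auto
  qed
  then obtain s where "s \<in> P" "s \<noteq> t" "(- n) \<bullet> t \<le> (- n) \<bullet> s" by auto
  then obtain s' where "s' \<in> P" "s' \<noteq> t" "(- n) \<bullet> t \<le> (- n) \<bullet> s'" "sees t s'"
    using sees_point_above[of t s "- n"] t by blast
  moreover from this have "s' \<in> S" using below[of s'] by force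
  ultimately show ?thesis using that by blast
qed

text \<open>The cyclic order is cut open at the start of the removed arc, so the arc is a prefix of
  \<open>ws\<close> and the remaining hull vertices form a path.\<close>

lemma card_hull_vertices_after_removal:
  assumes ws: "distinct ws" "set ws = hull_vertices P"
    and edges: "\<And>i. Suc i < length ws \<Longrightarrow> closed_segment (ws ! i) (ws ! Suc i) edge_of convex hull P"
  shows "card (hull_vertices (P - set (take k ws))) \<le> card (P - hull_vertices P) + 1"
proof -
  define S R N where "S = set (take k ws)" and "R = drop k ws" and "N = P - hull_vertices P"
  have hP: "hull_vertices P \<subseteq> P" by (auto simp: hull_vertices_def)
  have SH: "S \<subseteq> hull_vertices P" using ws(2) set_take_subset[of k ws] by (simp add: S_def)
  have split: "hull_vertices P = S \<union> set R" "S \<inter> set R = {}"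
    using ws append_take_drop_id[of k ws] set_take_disj_set_drop_if_distinct[of ws k k]
    by (auto simp: S_def R_def simp flip: set_append)
  have "\<exists>x. x \<in> N \<and> sees (R ! i) x \<and> sees (R ! Suc i) x" if i: "Suc i < length R" for i
  proof -
    have mem: "R ! i \<in> hull_vertices P" "R ! Suc i \<in> hull_vertices P"
      using i split by auto
    have "closed_segment (R ! i) (R ! Suc i) edge_of convex hull P"
      using edges[of "k + i"] i by (simp add: R_def)
    then obtain n where "R ! i \<noteq> R ! Suc i" "n \<bullet> (R ! Suc i) = n \<bullet> (R ! i)"
      "\<And>p. p \<in> P - {R ! i, R ! Suc i} \<Longrightarrow> n \<bullet> (R ! i) < n \<bullet> p"
      using hull_edge_supporting mem hP by blast
    then show ?thesis using hull_edge_apex[OF mem] unfolding N_def by metis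
  qed
  then obtain x where x: "\<And>i. Suc i < length R \<Longrightarrow> x i \<in> N \<and> sees (R ! i) (x i) \<and> sees (R ! Suc i) (x i)"
    by metis
  have dR: "distinct R" using ws(1) by (simp add: R_def)
  have three: False if "y \<in> N" "a \<in> hull_vertices P" "b \<in> hull_vertices P" "c \<in> hull_vertices P"
    "a \<noteq> b" "b \<noteq> c" "a \<noteq> c" "sees a y" "sees b y" "sees c y" for y a b c
    using not_sees_three_hull_vertices[of y a b c] that by (auto simp: N_def sees_commute)
  let ?I = "{i. Suc i < length R}"
  have I: "?I = {..<length R - 1}" by auto
  have RH: "R ! i \<in> hull_vertices P" if "i < length R" for i using that split by auto
  \<comment> \<open>A common apex would see \<open>R ! i\<close>, \<open>R ! Suc i\<close> and
    \<open>R ! Suc j\<close>, which are distinct since \<open>i < j\<close>.\<close>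
  have neq: "x i \<noteq> x j" if ij: "i < j" "Suc j < length R" for i j
  proof
    assume "x i = x j"
    then show False
      using three[of "x i" "R ! i" "R ! Suc i" "R ! Suc j"] x[of i] x[of j] ij RH dR
      by (simp add: nth_eq_iff_index_eq)
  qed
  have inj: "inj_on x ?I"
  proof (rule inj_onI)
    fix i j assume "i \<in> ?I" "j \<in> ?I" "x i = x j"
    then show "i = j" using neq[of i j] neq[of j i] by (cases i j rule: linorder_cases) auto
  qed
  \<comment> \<open>An apex already sees two remaining hull vertices; a removed point would be a
    third.\<close>
  have notin: "x i \<notin> hull_vertices (P - S)" if i: "i \<in> ?I" for i
  proof
    assume "x i \<in> hull_vertices (P - S)"
    then obtain s where s: "s \<in> S" "sees (x i) s"
      using new_hull_vertex_sees_removed_point[OF _ SH] x[of i] i by (auto simp: N_def)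
    have "R ! i \<notin> S" "R ! Suc i \<notin> S" using i split(2) by (auto dest: nth_mem)
    then show False
      using three[of "x i" "R ! i" "R ! Suc i" s] x[of i] i s RH SH dR
      by (auto simp: nth_eq_iff_index_eq sees_commute)
  qed
  have finN: "finite N" using finite_P by (simp add: N_def)
  have sub: "x ` ?I \<subseteq> N" using x by auto
  have "hull_vertices (P - S) \<subseteq> P - S" by (auto simp: hull_vertices_def)
  then have "hull_vertices (P - S) \<subseteq> set R \<union> (N - x ` ?I)"
    using notin split by (auto simp: N_def)
  then have "card (hull_vertices (P - S)) \<le> card (set R \<union> (N - x ` ?I))"
    using finN by (intro card_mono) auto
  also have "\<dots> \<le> card (set R) + card (N - x ` ?I)" by (rule card_Un_le)
  also have "card (set R) = length R" using dR by (rule distinct_card)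
  also have "card (N - x ` ?I) = card N - (length R - 1)"
    using sub finN inj by (subst card_Diff_subset) (auto simp: card_image I finite_subset)
  also have "length R + (card N - (length R - 1)) \<le> card N + 1"
  proof -
    have "length R - 1 \<le> card N"
      using card_mono[OF finN sub] inj by (simp add: card_image I)
    then show ?thesis by simp
  qed
  finally show ?thesis by (simp add: S_def N_def)
qed

end

theorem mainTheorem5:
  fixes P S Q :: "(real ^ 2) set"
  assumes "finite P"
    and "general_position P"
    and "four_connectible P"
    and "consecutive_on_hull P S"
    and "Q = P - S"
  shows "card (hull_vertices Q) \<le> card (interior_points P) + 1"
proof -
  obtain E where "plane_straight_line_graph P E" "four_connected P E"
    using assms(3) by (auto simp: four_connectible_def)
  then interpret four_connected_drawing P E using assms by unfold_locales
  obtain vs a k where vs: "hull_cyclic_order P vs" and S: "S = set (take k (rotate a vs))"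
    using assms(4) by (auto simp: consecutive_on_hull_def)
  let ?ws = "rotate a vs"
  have "card (hull_vertices (P - set (take k ?ws))) \<le> card (P - hull_vertices P) + 1"
  proof (rule card_hull_vertices_after_removal)
    show "distinct ?ws" "set ?ws = hull_vertices P" using vs by (simp_all add: hull_cyclic_order_def)
    fix i assume i: "Suc i < length ?ws"
    \<comment> \<open>Rotation shifts indices modulo the length, so neighbours in the rotated list
      stay cyclically adjacent in \<open>vs\<close>.\<close>
    then have "?ws ! Suc i = vs ! (Suc ((a + i) mod length vs) mod length vs)"
      by (simp add: nth_rotate mod_Suc_eq)
    moreover have "?ws ! i = vs ! ((a + i) mod length vs)" using i by (simp add: nth_rotate)
    moreover have "(a + i) mod length vs < length vs" using i by (intro mod_less_divisor) auto
    ultimately show "closed_segment (?ws ! i) (?ws ! Suc i) edge_of convex hull P"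
      using vs by (simp add: hull_cyclic_order_def)
  qed
  also have "card (P - hull_vertices P) \<le> card (interior_points P)"
    using non_hull_vertices_interior[OF finite_P general_position_P] card_P finite_P
    by (intro card_mono) (auto simp: interior_points_def)
  finally show ?thesis using assms(5) S by simp
qed

end
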